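(* For every integer $n\ge 0$, the map $\phi$ (defined in the context) is a bijection between the set $\mathcal{P}_{n+1}(12321)$ of $12321$-avoiding partitions of $[n+1]$ and the set $\mathcal{SH}_n$ of UH-free Schröder paths of semilength $n$.
   Context: A partition of $[m]=\{1,\dots,m\}$ with blocks $B_1,\dots,B_k$ (nonempty, disjoint, with union $[m]$), listed so that $\min B_1<\min B_2<\cdots<\min B_k$, is represented by its canonical sequential form: the word $\pi_1\pi_2\cdots\pi_m$ on $\{1,\dots,k\}$ with $\pi_i=j$ if and only if $i\in B_j$. Partitions are identified with these words. A partition $\pi$ avoids a partition (pattern) $\tau$ if the word $\pi$ has no (not necessarily contiguous) subsequence order-isomorphic to $\tau$; $\mathcal{P}_m(\tau)$ denotes the set of $\tau$-avoiding partitions of $[m]$. A Schröder path of semilength $n$ is a lattice path from $(0,0)$ to $(2n,0)$ that never goes below the $x$-axis and consists of up steps $U=(1,1)$, down steps $D=(1,-1)$ and horizontal steps $H=(2,0)$. It is UH-free if no up step is immediately followed by a horizontal step. $\mathcal{SH}_n$ is the set of UH-free Schröder paths of semilength $n$. Definition of $\phi$. Let $\pi$ be a $12321$-avoiding partition of $[n+1]$ with $k$ blocks. If $\pi=1$, then $\phi(\pi)$ is the empty path. Otherwise write $\pi$ uniquely as $1w_12w_2\cdots kw_k$, where the displayed letters $1,2,\dots,k$ are the left-to-right maxima of $\pi$ (the first occurrences of the letters) and each $w_i$ is a possibly empty word on $\{1,\dots,i\}$. For $1\le i\le k-1$ let $d_i$ be the number of occurrences of the letter $i$ to the right of the first occurrence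 of $i+1$. Read $\pi$ from left to right and build $\phi(\pi)$ by appending steps as follows: the initial letter $1$ contributes nothing; when the left-to-right maximum $i\ge 2$ is read, append $d_{i-1}+1$ up steps followed by one down step; when a letter of $w_i$ that is less than $i$ is read, append one down step; when a letter of $w_i$ equal to $i$ is read, append one horizontal step. *)

theory Defs
  imports Main "HOL-Library.Sublist" "HOL-Library.Disjoint_Sets"
begin

section \<open>Set partitions and their canonical sequential forms\<close>

definition blocks :: "nat set set \<Rightarrow> nat set list" where
  "blocks P = sorted_key_list_of_set Min P"

text \<open>
  Blocks and letters are numbered from 1, list positions from 0: the letter \<open>\<pi>\<^sub>i\<close> is entry
  \<open>i - 1\<close> of the list, and the block \<open>B\<^sub>j\<close> is \<open>blocks P ! (j - 1)\<close>.
\<close>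
definition canonical_word :: "nat \<Rightarrow> nat set set \<Rightarrow> nat list" where
  "canonical_word m P =
     map (\<lambda>i. THE j. 1 \<le> j \<and> j \<le> length (blocks P) \<and> i \<in> blocks P ! (j - 1)) [1..<Suc m]"

definition order_isomorphic :: "nat list \<Rightarrow> nat list \<Rightarrow> bool" where
  "order_isomorphic u v \<longleftrightarrow> length u = length v \<and>
     (\<forall>i<length u. \<forall>j<length u. u ! i < u ! j \<longleftrightarrow> v ! i < v ! j)"

definition avoids :: "nat list \<Rightarrow> nat list \<Rightarrow> bool" where
  "avoids \<pi> \<tau> \<longleftrightarrow> \<not> (\<exists>u. subseq u \<pi> \<and> order_isomorphic u \<tau>)"

definition avoiding_partitions :: "nat \<Rightarrow> nat list \<Rightarrow> nat set set set" where
  "avoiding_partitions m \<tau> = {P. partition_on {1..m} P \<and> avoids (canonical_word m P) \<tau>}"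


section \<open>UH-free Schroeder paths\<close>

datatype step = Up | Down | Horiz

fun dx :: "step \<Rightarrow> int" where
  "dx Up = 1"
| "dx Down = 1"
| "dx Horiz = 2"

fun dy :: "step \<Rightarrow> int" where
  "dy Up = 1"
| "dy Down = -1"
| "dy Horiz = 0"

definition schroeder_paths :: "nat \<Rightarrow> step list set" where
  "schroeder_paths n =
     {p. sum_list (map dx p) = 2 * int n \<and> sum_list (map dy p) = 0 \<and>
         (\<forall>q. prefix q p \<longrightarrow> 0 \<le> sum_list (map dy q))}"

definition UH_free_schroeder_paths :: "nat \<Rightarrow> step list set" where
  "UH_free_schroeder_paths n = {p \<in> schroeder_paths n. \<not> sublist [Up, Horiz] p}"


section \<open>The map \<open>\<phi>\<close>\<close>

text \<open>The number \<open>d\<^sub>i\<close> of letters \<open>i\<close> to the right of the first occurrence of \<open>i + 1\<close>.\<close>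
definition num_right :: "nat list \<Rightarrow> nat \<Rightarrow> nat" where
  "num_right \<pi> i = count_list (dropWhile (\<lambda>a. a \<noteq> Suc i) \<pi>) i"

text \<open>
  The steps appended when the letter at (0-based) position \<open>i > 0\<close> is read.  A letter that is not a
  left-to-right maximum lies in the factor \<open>w\<^sub>j\<close>, where \<open>j\<close> is the maximum of the preceding letters.
\<close>
definition phi_steps :: "nat list \<Rightarrow> nat \<Rightarrow> step list" where
  "phi_steps \<pi> i =
     (let a = \<pi> ! i; j = Max (set (take i \<pi>)) in
      if j < a then replicate (num_right \<pi> (a - 1) + 1) Up @ [Down]
      else if a < j then [Down]
      else [Horiz])"

definition phi :: "nat list \<Rightarrow> step list" where
  "phi \<pi> = concat (map (phi_steps \<pi>) [1..<length \<pi>])"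

end

theory Submission
  imports Defs
begin

text \<open>
  Call a letter of a canonical word low if it is smaller than some earlier letter.  If a low \<open>b\<close> is
  followed by a smaller letter \<open>a\<close>, then, with \<open>c\<close> the maximum of the letters before this \<open>b\<close>, the
  first occurrences of \<open>a\<close>, \<open>b\<close>, \<open>c\<close> complete a 12321; so avoidance means that the low letters
  increase weakly.  Such a word is determined by the numbers \<open>d\<^sub>i\<close> of low letters \<open>i\<close> and by which
  positions are low, repeat the current maximum, or exceed it.  A UH-free path records exactly this:
  each maximal run of up steps is followed by a down step and encodes a new maximum together with the
  next \<open>d\<^sub>i\<close>.  The height of the path is the number of announced low letters not yet placed, so that
  nonnegativity says that every low letter is smaller than the maximum before it.
\<close>

section \<open>Restricted growth words\<close>

text \<open>In the functions on words below, \<open>j\<close> is the maximum of the letters already read.\<close>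

fun restricted_growth :: "nat \<Rightarrow> nat list \<Rightarrow> bool" where
  "restricted_growth j [] \<longleftrightarrow> True"
| "restricted_growth j (a # w) \<longleftrightarrow> 1 \<le> a \<and> a \<le> Suc j \<and> restricted_growth (max j a) w"

fun low_letters :: "nat \<Rightarrow> nat list \<Rightarrow> nat list" where
  "low_letters j [] = []"
| "low_letters j (a # w) = (if a < j then a # low_letters j w else low_letters a w)"

lemma restricted_growth_pos: "restricted_growth j w \<Longrightarrow> a \<in> set w \<Longrightarrow> 1 \<le> a"
  by (induction w arbitrary: j) auto

lemma set_append_singleton_eq_interval:
  assumes "set u = {1..j}" "1 \<le> a" "a \<le> Suc j"
  shows "set (u @ [a]) = {1..max j a}"
proof (cases "a = Suc j")
  case True
  with assms show ?thesis by (simp add: atLeastAtMostSuc_conv)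
next
  case False
  with assms have "a \<in> set u" "max j a = j" by auto
  with assms show ?thesis by (simp add: insert_absorb)
qed

text \<open>The prefix \<open>u\<close> makes the induction go through: when the letters read are
  \<open>{1..j}\<close>, a positive letter is at most \<open>Suc j\<close> iff all smaller positive
  letters have been read.\<close>

lemma restricted_growth_append:
  assumes "set u = {1..j}"
  shows "restricted_growth j w \<longleftrightarrow>
    (\<forall>i<length w. 1 \<le> w ! i \<and> {1..<w ! i} \<subseteq> set (u @ take i w))"
  using assms
proof (induction w arbitrary: u j)
  case (Cons a w)
  show ?case
  proof (cases "1 \<le> a \<and> a \<le> Suc j")
    case True
    then have "set (u @ [a]) = {1..max j a}"
      using Cons.prems by (intro set_append_singleton_eq_interval) auto
    from Cons.IH[OF this] True Cons.prems show ?thesis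
      by (simp add: All_less_Suc2 subset_iff disj_left_commute)
  next
    case False
    \<comment> \<open>A letter above \<open>Suc j\<close> skips the value
      \<open>Suc j\<close>.\<close>
    then have "\<not> (1 \<le> a \<and> {1..<a} \<subseteq> {1..j})"
      by (auto simp: subset_iff intro!: exI[of _ "Suc j"])
    with False Cons.prems show ?thesis
      by (auto simp: All_less_Suc2)
  qed
qed simp

lemma restricted_growth_iff:
  "restricted_growth 0 w \<longleftrightarrow> (\<forall>i<length w. 1 \<le> w ! i \<and> {1..<w ! i} \<subseteq> set (take i w))"
  using restricted_growth_append[of "[]" 0 w] by simp

text \<open>Only letters that reach the running maximum are dropped, and this maximum never falls
  below \<open>j\<close>.\<close>

lemma filter_low_letters: "filter (\<lambda>a. a < j) (low_letters j w) = filter (\<lambda>a. a < j) w"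
proof (induction w arbitrary: j)
  case (Cons a w)
  have "filter (\<lambda>b. b < j) (low_letters a w) = filter (\<lambda>b. b < j) w" if "j \<le> a"
  proof -
    \<comment> \<open>Filtering through the larger bound \<open>a\<close> first makes the induction
      hypothesis for \<open>a\<close> applicable.\<close>
    have "filter (\<lambda>b. b < j) xs = filter (\<lambda>b. b < j) (filter (\<lambda>b. b < a) xs)" for xs
      using that by (induction xs) auto
    then show ?thesis
      using Cons.IH[of a] by metis
  qed
  with Cons.IH[of j] show ?case
    by auto
qed simp

lemma sorted_eq_filter_append_replicate:
  fixes j :: nat
  shows "sorted xs \<Longrightarrow> \<forall>x\<in>set xs. x < Suc j \<Longrightarrow>
    xs = filter (\<lambda>a. a < j) xs @ replicate (count_list xs j) j"
proof (induction xs)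
  case (Cons a xs)
  show ?case
  proof (cases "a = j")
    case True
    with Cons have "filter (\<lambda>a. a < j) xs = []"
      by (force simp: filter_empty_conv)
    with Cons True show ?thesis by simp
  qed (use Cons in auto)
qed simp

lemma count_list_filter: "count_list (filter P xs) x = (if P x then count_list xs x else 0)"
  by (induction xs) auto

text \<open>When the new maximum \<open>Suc j\<close> is read, the queue of low letters still to
  come grows at its end by the copies of \<open>j\<close>. After that maximum every letter up to
  \<open>j\<close> is low, so these letters come in weakly increasing order.\<close>

lemma filter_less_Suc_if_sorted_low_letters:
  assumes "sorted (low_letters (Suc j) w)"
  shows "filter (\<lambda>a. a < Suc j) w = filter (\<lambda>a. a < j) w @ replicate (count_list w j) j"
proof -
  have "sorted (filter (\<lambda>a. a < Suc j) w)"
    using assms by (metis filter_low_letters sorted_wrt_filter)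
  from sorted_eq_filter_append_replicate[OF this, of j] show ?thesis
    by (simp add: count_list_filter cong: conj_cong)
       (metis (mono_tags, lifting) filter_cong less_Suc_eq)
qed


section \<open>Avoidance of 12321\<close>

lemma subseq_low_letters:
  "subseq v w \<Longrightarrow> \<forall>a\<in>set v. a < j \<Longrightarrow> subseq v (low_letters j w)"
proof (induction w arbitrary: j v)
  case (Cons a w)
  show ?case
  proof (cases v)
    case (Cons b v')
    show ?thesis
    proof (cases "a < j")
      case True
      with Cons.IH Cons.prems Cons show ?thesis by (auto split: if_splits)
    next
      case False
      with Cons.prems Cons have "b \<noteq> a" by auto
      with Cons.prems Cons have "subseq v w" by auto
      with False Cons.prems Cons.IH[of v a] show ?thesis by force
    qed
  qed simp
qed simp

text \<open>Once \<open>c\<close> has been read, the running maximum is at least \<open>c\<close>,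
  so all of \<open>v\<close> is low.\<close>

lemma subseq_low_letters_Cons:
  "subseq (c # v) w \<Longrightarrow> \<forall>a\<in>set v. a < c \<Longrightarrow> subseq v (low_letters j w)"
proof (induction w arbitrary: j)
  case (Cons a w)
  show ?case
  proof (cases "c = a \<and> subseq v w")
    case True
    with Cons.prems have "\<forall>x\<in>set v. x < j" if "a < j"
      using that by force
    with True Cons.prems subseq_low_letters[of v w] show ?thesis
      by (auto intro: list_emb_Cons)
  next
    case False
    with Cons.prems have "subseq (c # v) w"
      by (auto split: if_splits intro: subseq_Cons')
    with Cons show ?thesis by (auto intro: list_emb_Cons)
  qed
qed simp

lemma order_isomorphic_12321_iff:
  "order_isomorphic u [1, 2, 3, 2, 1] \<longleftrightarrow> (\<exists>a b c. u = [a, b, c, b, a] \<and> a < b \<and> b < c)"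
proof
  assume iso: "order_isomorphic u [1, 2, 3, 2, 1]"
  then obtain a b c d e where u: "u = [a, b, c, d, e]"
    by (auto simp: order_isomorphic_def length_Suc_conv numeral_eq_Suc)
  with iso have "a < b" "b < c" "d = b" "e = a"
    by (auto simp: order_isomorphic_def All_less_Suc numeral_eq_Suc)
  with u show "\<exists>a b c. u = [a, b, c, b, a] \<and> a < b \<and> b < c" by simp
next
  assume "\<exists>a b c. u = [a, b, c, b, a] \<and> a < b \<and> b < c"
  then obtain a b c where "u = [a, b, c, b, a]" "a < b" "b < c" by blast
  then show "order_isomorphic u [1, 2, 3, 2, 1]"
    by (simp add: order_isomorphic_def All_less_Suc numeral_eq_Suc)
qed

lemma avoids_12321_iff:
  "avoids w [1, 2, 3, 2, 1] \<longleftrightarrow> \<not> (\<exists>a b c. a < b \<and> b < c \<and> subseq [a, b, c, b, a] w)"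
  unfolding avoids_def order_isomorphic_12321_iff by blast

text \<open>The tail \<open>c, b, a\<close> of a 12321 puts the strict descent \<open>b, a\<close>
  among the low letters.\<close>

lemma avoids_12321_if_sorted_low_letters:
  assumes "sorted (low_letters j w)"
  shows "avoids w [1, 2, 3, 2, 1]"
  unfolding avoids_12321_iff
proof clarify
  fix a b c :: nat
  assume *: "a < b" "b < c" "subseq [a, b, c, b, a] w"
  then have "subseq [c, b, a] w"
    by (meson subseq_Cons')
  with * have "subseq [b, a] (low_letters j w)"
    by (intro subseq_low_letters_Cons[of c]) auto
  with assms have "sorted [b, a]"
    by (metis subseq_conv_nths sorted_nths)
  with * show False by simp
qed

text \<open>Here \<open>u\<close> is the part already read; containing \<open>1, ..., j\<close> in
  this order, it supplies the first three letters of a forbidden pattern.\<close>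

lemma sorted_low_letters_if_avoids_12321:
  assumes "avoids (u @ w) [1, 2, 3, 2, 1]" "restricted_growth j w"
    and "subseq [1..<Suc j] u" "\<forall>a\<in>set u. 1 \<le> a"
  shows "sorted (low_letters j w)"
  using assms
proof (induction w arbitrary: u j)
  case (Cons a w)
  have av: "avoids ((u @ [a]) @ w) [1, 2, 3, 2, 1]"
    using Cons.prems by simp
  show ?case
  proof (cases "a < j")
    case True
    have "sorted (low_letters j w)"
      using Cons.prems True by (intro Cons.IH[OF av]) (auto simp: max_def)
    moreover have "a \<le> b" if b: "b \<in> set (low_letters j w)" for b
    proof (rule ccontr)
      assume "\<not> a \<le> b"
      have bw: "b \<in> set w"
        using b by (induction w arbitrary: j) (auto split: if_splits)
      then have "1 \<le> b"
        using Cons.prems restricted_growth_pos by force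
      \<comment> \<open>With \<open>b < a < j\<close>, the pattern being built is
        \<open>b, a, j, a, b\<close>, its last two letters lying in \<open>a # w\<close>.\<close>
      have "subseq [b, a, j] [1..<Suc j]"
        using \<open>1 \<le> b\<close> \<open>\<not> a \<le> b\<close> True by (intro sorted_subset_imp_subseq) (auto simp del: upt_Suc)
      then have "subseq [b, a, j] u"
        using Cons.prems subseq_order.order_trans by blast
      moreover have "subseq [a, b] (a # w)"
        using bw by (simp add: subseq_singleton_left)
      ultimately have "subseq ([b, a, j] @ [a, b]) (u @ a # w)"
        by (rule list_emb_append_mono)
      with Cons.prems True \<open>\<not> a \<le> b\<close> show False
        unfolding avoids_12321_iff by (metis append_Cons append_Nil not_le)
    qed
    ultimately show ?thesis using True by simp
  next
    case False
    then have "a = j \<or> a = Suc j" "1 \<le> a" using Cons.prems by auto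
    moreover have "subseq [1..<Suc a] (u @ [a])"
      using \<open>a = j \<or> a = Suc j\<close> Cons.prems(3) subseq_append
      by (metis subseq_rev_drop_many upt_Suc_append le_add1 plus_1_eq_Suc)
    ultimately show ?thesis
      using False Cons.prems Cons.IH[OF av, of a] by (auto simp: max_def)
  qed
qed simp

lemma avoids_12321_iff_sorted_low_letters:
  assumes "restricted_growth 0 w"
  shows "avoids w [1, 2, 3, 2, 1] \<longleftrightarrow> sorted (low_letters 0 w)"
  using avoids_12321_if_sorted_low_letters[of 0 w] sorted_low_letters_if_avoids_12321[of "[]" w 0]
    assms by auto


section \<open>Canonical words are the restricted growth words\<close>

text \<open>The inverse of \<open>canonical_word\<close>. The shifts by one reconcile elements
  counted from 1 with list positions counted from 0.\<close>

definition kernel_partition :: "nat \<Rightarrow> nat list \<Rightarrow> nat set set" where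
  "kernel_partition m w = (\<lambda>i. {i'\<in>{1..m}. w ! (i - 1) = w ! (i' - 1)}) ` {1..m}"

text \<open>Meant for the key \<open>Min\<close>, which is injective on the blocks of a partition
  but not on all sets; hence the interpretation over \<open>S\<close> itself.\<close>

lemma (in linorder) sorted_key_list_of_set_if_inj_on:
  assumes "inj_on f S" "finite S"
  shows "set (sorted_key_list_of_set f S) = S"
    and "sorted_wrt (<) (map f (sorted_key_list_of_set f S))"
proof -
  interpret folding_insort_key "(\<le>)" "(<)" S f
    by unfold_locales (rule assms)
  show "set (sorted_key_list_of_set f S) = S"
    and "sorted_wrt (<) (map f (sorted_key_list_of_set f S))"
    using assms by simp_all
qed

context
  fixes m :: nat and P :: "nat set set"
  assumes part: "partition_on {1..m} P"
begin

lemma finite_block: "B \<in> P \<Longrightarrow> finite B" and block_nonempty: "B \<in> P \<Longrightarrow> B \<noteq> {}"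
  using part by (auto simp: partition_on_def intro!: finite_subset[of B "{1..m}"])

lemma blocks_eqI: "B \<in> P \<Longrightarrow> C \<in> P \<Longrightarrow> i \<in> B \<Longrightarrow> i \<in> C \<Longrightarrow> B = C"
  using part unfolding partition_on_def by (meson disjointD disjoint_iff)

lemma block_subset: "B \<in> P \<Longrightarrow> B \<subseteq> {1..m}"
  using partition_onD1[OF part] by blast

lemma ex_block: "i \<in> {1..m} \<Longrightarrow> \<exists>B\<in>P. i \<in> B"
  using partition_onD1[OF part] by blast

text \<open>A shared minimum would be a common element of two blocks.\<close>

lemma inj_on_Min_blocks: "inj_on Min P"
  by (rule inj_onI) (metis Min_in blocks_eqI block_nonempty finite_block)

lemma set_blocks: "set (blocks P) = P"
  and sorted_blocks: "sorted_wrt (<) (map Min (blocks P))"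
  using inj_on_Min_blocks finite_elements[OF _ part] unfolding blocks_def
  by (simp_all add: sorted_key_list_of_set_if_inj_on)

lemma block_index_eqI:
  assumes "k < length (blocks P)" "l < length (blocks P)" "i \<in> blocks P ! k" "i \<in> blocks P ! l"
  shows "k = l"
proof -
  have "blocks P ! k = blocks P ! l"
    using assms set_blocks blocks_eqI nth_mem by metis
  moreover have "distinct (blocks P)"
    using sorted_blocks by (simp add: strict_sorted_iff distinct_map)
  ultimately show ?thesis
    using assms nth_eq_iff_index_eq by blast
qed

lemma length_canonical_word: "length (canonical_word m P) = m"
  by (simp add: canonical_word_def)

text \<open>Eliminates the definite description: the blocks cover \<open>{1..m}\<close>, and no
  element lies in two entries of \<open>blocks P\<close>.\<close>

lemma canonical_word_nth_eq_iff:
  assumes "i < m"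
  shows "canonical_word m P ! i = j \<longleftrightarrow>
    1 \<le> j \<and> j \<le> length (blocks P) \<and> Suc i \<in> blocks P ! (j - 1)" (is "_ \<longleftrightarrow> ?Q j")
proof -
  obtain B where "B \<in> P" "Suc i \<in> B"
    using assms ex_block[of "Suc i"] by auto
  then obtain k where "k < length (blocks P)" "Suc i \<in> blocks P ! k"
    using set_blocks in_set_conv_nth by metis
  then have "?Q (Suc k)"
    by simp
  moreover have uniq: "j = l" if "?Q j" "?Q l" for j l
  proof -
    have "j - 1 = l - 1"
      using that by (intro block_index_eqI[of _ _ "Suc i"]) auto
    with that show ?thesis by linarith
  qed
  ultimately have "?Q (THE j. ?Q j)"
    by (intro theI[of ?Q "Suc k"]) blast+
  moreover have "canonical_word m P ! i = (THE j. ?Q j)"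
    using assms unfolding canonical_word_def by (subst nth_map) (auto simp del: upt_Suc)
  ultimately show ?thesis
    using uniq by metis
qed

lemma canonical_word_nth_eq_nth_iff:
  assumes "i < m" "i' < m"
  shows "canonical_word m P ! i = canonical_word m P ! i' \<longleftrightarrow> (\<exists>B\<in>P. Suc i \<in> B \<and> Suc i' \<in> B)"
proof
  assume eq: "canonical_word m P ! i = canonical_word m P ! i'"
  define j where "j = canonical_word m P ! i"
  have "1 \<le> j" "j \<le> length (blocks P)" "Suc i \<in> blocks P ! (j - 1)"
    using canonical_word_nth_eq_iff[OF assms(1), of j] by (simp_all add: j_def)
  moreover have "Suc i' \<in> blocks P ! (j - 1)"
    using canonical_word_nth_eq_iff[OF assms(2), of j] eq by (simp add: j_def)
  moreover from calculation have "blocks P ! (j - 1) \<in> set (blocks P)"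
    by (intro nth_mem) linarith
  ultimately show "\<exists>B\<in>P. Suc i \<in> B \<and> Suc i' \<in> B"
    using set_blocks by blast
next
  assume "\<exists>B\<in>P. Suc i \<in> B \<and> Suc i' \<in> B"
  then obtain k where k: "k < length (blocks P)" "Suc i \<in> blocks P ! k" "Suc i' \<in> blocks P ! k"
    using set_blocks in_set_conv_nth by metis
  then have "canonical_word m P ! i = Suc k" "canonical_word m P ! i' = Suc k"
    using canonical_word_nth_eq_iff[OF assms(1)] canonical_word_nth_eq_iff[OF assms(2)] by simp_all
  then show "canonical_word m P ! i = canonical_word m P ! i'" by simp
qed

text \<open>If \<open>b < j\<close>, the minimum of block \<open>b\<close> precedes that of block
  \<open>j\<close>, hence every element of block \<open>j\<close>; so the letter \<open>b\<close>
  occurs before any letter \<open>j\<close>.\<close>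

lemma restricted_growth_canonical_word: "restricted_growth 0 (canonical_word m P)"
  unfolding restricted_growth_iff
proof (intro allI impI conjI subsetI)
  fix i assume "i < length (canonical_word m P)"
  then have i: "i < m" by (simp add: length_canonical_word)
  define j where "j = canonical_word m P ! i"
  have j: "1 \<le> j" "j \<le> length (blocks P)" "Suc i \<in> blocks P ! (j - 1)"
    using canonical_word_nth_eq_iff[OF i] j_def by auto
  then show "1 \<le> canonical_word m P ! i" by (simp add: j_def)
  fix b assume "b \<in> {1..<canonical_word m P ! i}"
  then have b: "1 \<le> b" "b < j" by (auto simp: j_def)
  define B C where "B = blocks P ! (b - 1)" and "C = blocks P ! (j - 1)"
  have BC: "B \<in> P" "C \<in> P"
    using b j set_blocks nth_mem unfolding B_def C_def by (metis Suc_le_eq Suc_diff_1 less_trans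
      less_le_trans zero_less_one diff_less diff_less_mono)+
  have "Min B < Min C"
    using sorted_wrt_nth_less[OF sorted_blocks, of "b - 1" "j - 1"] b j unfolding B_def C_def by auto
  also have "Min C \<le> Suc i"
    using j BC finite_block unfolding C_def by simp
  finally have less: "Min B < Suc i" .
  have "Min B \<in> B"
    using BC finite_block block_nonempty by simp
  moreover from this have "1 \<le> Min B"
    using BC block_subset by fastforce
  ultimately have "canonical_word m P ! (Min B - 1) = b"
    using b j i less by (subst canonical_word_nth_eq_iff) (auto simp: B_def)
  then show "b \<in> set (take i (canonical_word m P))"
    using less \<open>1 \<le> Min B\<close> i length_canonical_word
    by (auto simp: in_set_conv_nth intro!: exI[of _ "Min B - 1"])
qed

lemma kernel_partition_canonical_word: "kernel_partition m (canonical_word m P) = P"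
proof -
  let ?K = "\<lambda>i. {i'\<in>{1..m}. canonical_word m P ! (i - 1) = canonical_word m P ! (i' - 1)}"
  have K: "?K i = B" if "B \<in> P" "i \<in> B" for i B
  proof -
    have sub: "B \<subseteq> {1..m}" using that block_subset by blast
    have "i' \<in> ?K i \<longleftrightarrow> i' \<in> B" for i'
    proof (cases "i' \<in> {1..m}")
      case True
      have "i \<in> {1..m}" using sub that by auto
      with True have "i - 1 < m" "i' - 1 < m" "Suc (i - 1) = i" "Suc (i' - 1) = i'"
        by auto
      with True have "i' \<in> ?K i \<longleftrightarrow> (\<exists>B\<in>P. i \<in> B \<and> i' \<in> B)"
        using canonical_word_nth_eq_nth_iff[of "i - 1" "i' - 1"] by simp
      also have "\<dots> \<longleftrightarrow> i' \<in> B"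
        using that blocks_eqI by blast
      finally show ?thesis .
    qed (use sub in auto)
    then show ?thesis by blast
  qed
  show ?thesis
    unfolding kernel_partition_def
  proof (intro equalityI subsetI)
    fix B assume "B \<in> P"
    moreover from this obtain i where "i \<in> B"
      using block_nonempty by blast
    moreover from calculation have "i \<in> {1..m}"
      using block_subset by blast
    ultimately show "B \<in> ?K ` {1..m}"
      using K by blast
  next
    fix B assume "B \<in> ?K ` {1..m}"
    then obtain i where "i \<in> {1..m}" "B = ?K i" by blast
    moreover from this obtain C where "C \<in> P" "i \<in> C"
      using ex_block by blast
    ultimately show "B \<in> P" using K by metis
  qed
qed

end

section \<open>Recovering a restricted growth word from its kernel\<close>

lemma restricted_growth_eq_if_same_kernel:
  assumes "restricted_growth 0 v" "restricted_growth 0 w" "length v = length w"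
    and ker: "\<And>i i'. i < length w \<Longrightarrow> i' < length w \<Longrightarrow> v ! i = v ! i' \<longleftrightarrow> w ! i = w ! i'"
  shows "v = w"
proof -
  have "v ! i = w ! i" if "i < length w" for i
    using that
  proof (induction i rule: less_induct)
    case (less i)
    then have take: "take i v = take i w"
      using assms(3) by (auto intro: nth_take_lemma)
    \<comment> \<open>Stated for fresh \<open>v\<close> and \<open>w\<close> to serve both
      inequalities. If \<open>w ! i\<close> were smaller, it would already occur in the common
      prefix, and the equal kernels would force \<open>v ! i = w ! i\<close>.\<close>
    have "v ! i \<le> w ! i" if "restricted_growth 0 v" "restricted_growth 0 w" "length v = length w"
      and take: "take i v = take i w" "i < length w"
      and ker: "\<And>i'. i' < i \<Longrightarrow> v ! i = v ! i' \<longleftrightarrow> w ! i = w ! i'" for v w :: "nat list"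
    proof (rule ccontr)
      assume "\<not> v ! i \<le> w ! i"
      then have "w ! i \<in> {1..<v ! i}"
        using that by (auto simp: restricted_growth_iff)
      then have "w ! i \<in> set (take i v)"
        using that restricted_growth_iff by (metis subsetD)
      then obtain i' where i': "i' < i" "v ! i' = w ! i"
        using that by (auto simp: in_set_conv_nth)
      then have "w ! i' = w ! i"
        using take by (metis nth_take)
      with ker[OF i'(1)] i'(2) have "v ! i = w ! i" by metis
      with \<open>\<not> v ! i \<le> w ! i\<close> show False by simp
    qed
    note le = this
    have ker_i: "v ! i = v ! i' \<longleftrightarrow> w ! i = w ! i'" if "i' < i" for i'
      using that less.prems by (intro ker) auto
    show ?case
    proof (rule order.antisym)
      show "v ! i \<le> w ! i"
        using assms(1-3) take less.prems ker_i by (rule le)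
      have "i < length v" "\<And>i'. i' < i \<Longrightarrow> w ! i = w ! i' \<longleftrightarrow> v ! i = v ! i'"
        using less.prems assms(3) ker_i by simp_all
      with assms(2,1) assms(3)[symmetric] take[symmetric] show "w ! i \<le> v ! i"
        by (rule le)
    qed
  qed
  with assms(3) show ?thesis
    by (simp add: nth_equalityI)
qed

text \<open>\<open>kernel_partition\<close> is a left inverse, which gives injectivity; for
  surjectivity, \<open>w\<close> and the canonical word of its kernel partition have the same
  kernel.\<close>

lemma bij_betw_canonical_word:
  "bij_betw (canonical_word m) {P. partition_on {1..m} P} {w. length w = m \<and> restricted_growth 0 w}"
proof (rule bij_betwI')
  fix P Q assume "P \<in> {P. partition_on {1..m} P}" "Q \<in> {P. partition_on {1..m} P}"
  then show "canonical_word m P = canonical_word m Q \<longleftrightarrow> P = Q"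
    using kernel_partition_canonical_word[of m P] kernel_partition_canonical_word[of m Q]
    by (metis mem_Collect_eq)
next
  fix P assume "P \<in> {P. partition_on {1..m} P}"
  then show "canonical_word m P \<in> {w. length w = m \<and> restricted_growth 0 w}"
    using length_canonical_word restricted_growth_canonical_word by simp
next
  fix w assume "w \<in> {w. length w = m \<and> restricted_growth 0 w}"
  then have w: "length w = m" "restricted_growth 0 w" by auto
  define P where "P = kernel_partition m w"
  have part: "partition_on {1..m} P"
    by (rule partition_onI) (auto simp: P_def kernel_partition_def disjnt_iff)
  have "canonical_word m P = w"
  proof (rule restricted_growth_eq_if_same_kernel)
    fix i i' assume i: "i < length w" "i' < length w"
    then have "Suc i \<in> {1..m}" "Suc i' \<in> {1..m}" using w by auto
    then have "(\<exists>B\<in>P. Suc i \<in> B \<and> Suc i' \<in> B) \<longleftrightarrow> w ! i = w ! i'"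
      by (auto simp: P_def kernel_partition_def intro!: bexI[of _ "Suc i"])
    with i w show "canonical_word m P ! i = canonical_word m P ! i' \<longleftrightarrow> w ! i = w ! i'"
      using canonical_word_nth_eq_nth_iff[OF part] by simp
  qed (use w part length_canonical_word restricted_growth_canonical_word in auto)
  with part show "\<exists>P\<in>{P. partition_on {1..m} P}. w = canonical_word m P" by auto
qed

section \<open>The map phi and its inverse\<close>

text \<open>In a restricted growth word, \<open>j < a\<close> means that \<open>a\<close> is the
  first \<open>Suc j\<close>, so the count in the rest \<open>w\<close> is the number
  \<open>d_j\<close>.\<close>

fun phi_from :: "nat \<Rightarrow> nat list \<Rightarrow> step list" where
  "phi_from j [] = []"
| "phi_from j (a # w) =
    (if j < a then replicate (count_list w j + 1) Up @ Down # phi_from a w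
     else if a < j then Down # phi_from j w
     else Horiz # phi_from j w)"

text \<open>
  In the inverse map, \<open>q\<close> is the queue of the low letters that have been announced by up steps but
  not yet placed, and \<open>c\<close> is the number of up steps read since the last other step.
\<close>
fun phi_inv_from :: "nat \<Rightarrow> nat list \<Rightarrow> nat \<Rightarrow> step list \<Rightarrow> nat list" where
  "phi_inv_from j q c [] = []"
| "phi_inv_from j q c (Up # p) = phi_inv_from j q (Suc c) p"
| "phi_inv_from j q 0 (Down # p) = hd q # phi_inv_from j (tl q) 0 p"
| "phi_inv_from j q (Suc c) (Down # p) = Suc j # phi_inv_from (Suc j) (q @ replicate c j) 0 p"
| "phi_inv_from j q c (Horiz # p) = j # phi_inv_from j q 0 p"

text \<open>
  The path \<open>p\<close> completes one that ends at height \<open>h + c\<close> with exactly \<open>c\<close> up steps; the height \<open>h\<close>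
  is the length of the queue above.
\<close>
fun UH_free_path_from :: "nat \<Rightarrow> nat \<Rightarrow> step list \<Rightarrow> bool" where
  "UH_free_path_from c h [] \<longleftrightarrow> c = 0 \<and> h = 0"
| "UH_free_path_from c h (Up # p) \<longleftrightarrow> UH_free_path_from (Suc c) h p"
| "UH_free_path_from 0 h (Down # p) \<longleftrightarrow> 0 < h \<and> UH_free_path_from 0 (h - 1) p"
| "UH_free_path_from (Suc c) h (Down # p) \<longleftrightarrow> UH_free_path_from 0 (h + c) p"
| "UH_free_path_from c h (Horiz # p) \<longleftrightarrow> c = 0 \<and> UH_free_path_from 0 h p"

lemma all_prefix_Cons:
  "(\<forall>q. prefix q (x # p) \<longrightarrow> Q q) \<longleftrightarrow> Q [] \<and> (\<forall>q. prefix q p \<longrightarrow> Q (x # q))"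
  by (auto simp: prefix_Cons)

text \<open>The last conjunct excludes a UH straddling the boundary between the steps already read
  and \<open>p\<close>.\<close>

lemma UH_free_path_from_iff:
  "UH_free_path_from c h p \<longleftrightarrow>
    sum_list (map dy p) = - int (h + c) \<and>
    (\<forall>q. prefix q p \<longrightarrow> 0 \<le> int (h + c) + sum_list (map dy q)) \<and>
    \<not> sublist [Up, Horiz] p \<and> \<not> (0 < c \<and> prefix [Horiz] p)"
proof (induction c h p rule: UH_free_path_from.induct)
  case (3 h p)
  show ?case
  proof (cases h)
    case 0
    have "\<exists>q. prefix q (Down # p) \<and> sum_list (map dy q) < 0"
      by (rule exI[of _ "[Down]"]) simp
    with 0 show ?thesis by force
  next
    case (Suc h')
    with 3 show ?thesis
      by (auto simp: all_prefix_Cons sublist_Cons_right algebra_simps)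
  qed
qed (auto simp: all_prefix_Cons sublist_Cons_right algebra_simps)

lemma UH_free_schroeder_paths_iff:
  "p \<in> UH_free_schroeder_paths n \<longleftrightarrow>
    UH_free_path_from 0 0 p \<and> sum_list (map dx p) = 2 * int n"
  by (auto simp: UH_free_schroeder_paths_def schroeder_paths_def UH_free_path_from_iff)

lemma UH_free_path_from_replicate_Up:
  "UH_free_path_from c h (replicate k Up @ p) \<longleftrightarrow> UH_free_path_from (c + k) h p"
  by (induction k arbitrary: c) auto

lemma phi_inv_from_replicate_Up:
  "phi_inv_from j q c (replicate k Up @ p) = phi_inv_from j q (c + k) p"
  by (induction k arbitrary: c) auto

section \<open>Encoding words as paths and decoding them\<close>

lemma sum_list_dx_phi_from:
  "sum_list (map dx (phi_from j w)) = sum_list (map dy (phi_from j w)) + 2 * int (length w)"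
  by (induction w arbitrary: j) (auto simp: sum_list_replicate)

text \<open>The height before \<open>w\<close> counts the letters of \<open>w\<close> below
  \<open>j\<close>: a low letter lowers it by one, and a new maximum raises it by the number of
  letters \<open>j\<close> still to come.\<close>

lemma UH_free_path_from_phi_from:
  "restricted_growth j w \<Longrightarrow> sorted (low_letters j w) \<Longrightarrow>
    UH_free_path_from 0 (length (filter (\<lambda>a. a < j) w)) (phi_from j w)"
proof (induction w arbitrary: j)
  case (Cons a w)
  show ?case
  proof (cases "j < a")
    case True
    then have a: "a = Suc j" using Cons.prems by simp
    with Cons have "UH_free_path_from 0 (length (filter (\<lambda>a. a < Suc j) w)) (phi_from (Suc j) w)"
      by (simp add: max_def)
    with a Cons.prems show ?thesis
      by (simp add: UH_free_path_from_replicate_Up filter_less_Suc_if_sorted_low_letters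
          del: replicate_Suc)
  next
    case False
    with Cons show ?thesis by (cases "a = j") (auto simp: max_def)
  qed
qed simp

text \<open>The queue holds the letters of \<open>w\<close> below \<open>j\<close> in order of
  appearance, so its head is the next low letter.\<close>

lemma phi_inv_from_phi_from:
  "restricted_growth j w \<Longrightarrow> sorted (low_letters j w) \<Longrightarrow>
    phi_inv_from j (filter (\<lambda>a. a < j) w) 0 (phi_from j w) = w"
proof (induction w arbitrary: j)
  case (Cons a w)
  show ?case
  proof (cases "j < a")
    case True
    then have a: "a = Suc j" using Cons.prems by simp
    with Cons have
      "phi_inv_from (Suc j) (filter (\<lambda>a. a < Suc j) w) 0 (phi_from (Suc j) w) = w"
      by (simp add: max_def)
    with a Cons.prems show ?thesis
      by (simp add: phi_inv_from_replicate_Up filter_less_Suc_if_sorted_low_letters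
          del: replicate_Suc)
  next
    case False
    with Cons show ?thesis by (cases "a = j") (auto simp: max_def)
  qed
qed simp

text \<open>The claims are proved together: the low letters of the output are the queue followed by
  letters \<open>r\<close> that are at least \<open>j\<close>, and this determines the counts that
  \<open>phi_from\<close> turns back into up steps.\<close>

lemma phi_inv_from_correct:
  assumes "UH_free_path_from c (length q) p" "sorted q" "\<forall>x\<in>set q. 1 \<le> x \<and> x < j" "1 \<le> j"
  defines "w \<equiv> phi_inv_from j q c p"
  shows "restricted_growth j w \<and>
    (\<exists>r. low_letters j w = q @ r \<and> sorted r \<and> (\<forall>x\<in>set r. j \<le> x)) \<and>
    phi_from j w = replicate c Up @ p"
  using assms(1-4) unfolding w_def
proof (induction j q c p rule: phi_inv_from.induct)
  case (2 j q c p)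
  then show ?case
    by (simp add: replicate_app_Cons_same)
next
  case (3 j q p)
  then obtain a q' where q: "q = a # q'" by (cases q) auto
  with 3 show ?case
    by (auto simp: max_def)
next
  case (4 j q c p)
  define w where "w = phi_inv_from (Suc j) (q @ replicate c j) 0 p"
  have "restricted_growth (Suc j) w \<and>
    (\<exists>r. low_letters (Suc j) w = (q @ replicate c j) @ r \<and> sorted r \<and> (\<forall>x\<in>set r. Suc j \<le> x)) \<and>
    phi_from (Suc j) w = replicate 0 Up @ p"
    unfolding w_def using "4.prems" by (intro "4.IH") (auto simp: sorted_append intro: less_imp_le)
  then obtain r where r: "restricted_growth (Suc j) w" "phi_from (Suc j) w = p"
    "low_letters (Suc j) w = (q @ replicate c j) @ r" "sorted r" "\<forall>x\<in>set r. Suc j \<le> x"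
    by auto
  \<comment> \<open>Every \<open>j\<close> is low after \<open>Suc j\<close>; among the low letters,
    \<open>j\<close> occurs only in the block of \<open>c\<close> copies between \<open>q\<close>
    and \<open>r\<close>.\<close>
  have "count_list w j = count_list (filter (\<lambda>a. a < Suc j) (low_letters (Suc j) w)) j"
    by (simp add: filter_low_letters count_list_filter)
  also have "\<dots> = c"
  proof -
    have "j \<notin> set q" "j \<notin> set r" using "4.prems" r by auto
    then show ?thesis
      by (simp add: count_list_filter r(3) count_notin) (induction c; simp)
  qed
  finally have count: "count_list w j = c" .
  \<comment> \<open>Relative to the old queue \<open>q\<close>, the new copies of \<open>j\<close>
    belong to the remainder.\<close>
  have "sorted (replicate c j @ r)" "\<forall>x\<in>set (replicate c j @ r). j \<le> x"
    using r by (auto simp: sorted_append)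
  with r count show ?case
    by (auto simp: max_def simp flip: w_def intro!: exI[of _ "replicate c j @ r"])
qed auto


section \<open>The bijection\<close>

text \<open>Passes from positions to recursion: after a prefix with letter set
  \<open>{1..j}\<close>, the maximum of the preceding letters is \<open>j\<close>.\<close>

lemma phi_steps_append:
  assumes "set u = {1..j}" "1 \<le> j" "restricted_growth j w"
  shows "concat (map (phi_steps (u @ w)) [length u..<length (u @ w)]) = phi_from j w"
  using assms
proof (induction w arbitrary: u j)
  case (Cons a w)
  have "set (u @ [a]) = {1..max j a}"
    using Cons.prems by (intro set_append_singleton_eq_interval) auto
  then have IH: "concat (map (phi_steps (u @ a # w)) [Suc (length u)..<length (u @ a # w)]) =
      phi_from (max j a) w"
    using Cons.IH[of "u @ [a]" "max j a"] Cons.prems by auto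
  have "Max (set u) = j"
    using Cons.prems by (auto intro: Max_eqI)
  moreover have a: "a = Suc j" if "j < a"
    using that Cons.prems by simp
  \<comment> \<open>No letter of \<open>u\<close> is \<open>Suc j\<close>, so
    \<open>dropWhile\<close> removes exactly \<open>u\<close>, and the leading \<open>a\<close> is
    not counted.\<close>
  moreover have "num_right (u @ a # w) j = count_list w j" if "j < a"
  proof -
    note a[OF that]
    moreover have "\<forall>b\<in>set u. b \<noteq> Suc j" using Cons.prems by auto
    ultimately show ?thesis
      by (simp add: num_right_def dropWhile_append2)
  qed
  ultimately have "phi_steps (u @ a # w) (length u) @ phi_from (max j a) w = phi_from j (a # w)"
    by (auto simp: phi_steps_def Let_def max_def)
  moreover have "[length u..<length (u @ a # w)] = length u # [Suc (length u)..<length (u @ a # w)]"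
    by (rule upt_conv_Cons) simp
  ultimately show ?case
    using IH by simp
qed simp

lemma phi_Cons_1: "restricted_growth 1 w \<Longrightarrow> phi (1 # w) = phi_from 1 w"
  using phi_steps_append[of "[1]" 1 w] by (simp add: phi_def)

lemma restricted_growth_Suc_length_iff:
  "length w = Suc n \<and> restricted_growth 0 w \<longleftrightarrow>
    (\<exists>v. w = 1 # v \<and> length v = n \<and> restricted_growth 1 v)"
  by (cases w) (auto simp: le_Suc_eq max_def)

lemma bij_betw_phi:
  "bij_betw phi {w. length w = n + 1 \<and> restricted_growth 0 w \<and> sorted (low_letters 0 w)}
    (UH_free_schroeder_paths n)"
proof -
  let ?V = "{v. length v = n \<and> restricted_growth 1 v \<and> sorted (low_letters 1 v)}"
  let ?W = "{w. length w = n + 1 \<and> restricted_growth 0 w \<and> sorted (low_letters 0 w)}"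
  have "?W = (#) 1 ` ?V"
  proof (rule set_eqI)
    fix w
    show "w \<in> ?W \<longleftrightarrow> w \<in> (#) 1 ` ?V"
      using restricted_growth_Suc_length_iff[of w n] by (cases w) auto
  qed
  then have cons: "bij_betw ((#) 1) ?V ?W"
    by (simp add: bij_betw_def)
  \<comment> \<open>At the start the queue is empty and the height is 0.\<close>
  have no_low: "filter (\<lambda>a. a < 1) v = []" if "restricted_growth 1 v" for v
    using restricted_growth_pos[OF that] by (force simp: filter_empty_conv)
  have "bij_betw (phi_from 1) ?V (UH_free_schroeder_paths n)"
  proof (rule bij_betw_byWitness[where f' = "phi_inv_from 1 [] 0"])
    show "\<forall>v\<in>?V. phi_inv_from 1 [] 0 (phi_from 1 v) = v"
      using phi_inv_from_phi_from[of 1] no_low by auto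
    have inv: "restricted_growth 1 (phi_inv_from 1 [] 0 p) \<and> sorted (low_letters 1 (phi_inv_from 1 [] 0 p))
      \<and> phi_from 1 (phi_inv_from 1 [] 0 p) = p" if "UH_free_path_from 0 0 p" for p
      using phi_inv_from_correct[of 0 "[]" p 1] that by auto
    then show "\<forall>p\<in>UH_free_schroeder_paths n. phi_from 1 (phi_inv_from 1 [] 0 p) = p"
      by (simp add: UH_free_schroeder_paths_iff)
    have path: "UH_free_path_from 0 0 (phi_from 1 v)"
      if "restricted_growth 1 v" "sorted (low_letters 1 v)" for v
      using UH_free_path_from_phi_from[OF that] no_low that by simp
    \<comment> \<open>The path returns to height 0, so its width is twice the number of letters;
      this also yields the length of a decoded word.\<close>
    have dx: "sum_list (map dx p) = 2 * int (length v)"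
      if "UH_free_path_from 0 0 p" "p = phi_from 1 v" for v p
      using that sum_list_dx_phi_from[of 1 v] by (simp add: UH_free_path_from_iff)
    show "phi_from 1 ` ?V \<subseteq> UH_free_schroeder_paths n"
      using path dx by (auto simp: UH_free_schroeder_paths_iff)
    show "phi_inv_from 1 [] 0 ` UH_free_schroeder_paths n \<subseteq> ?V"
    proof clarify
      fix p assume "p \<in> UH_free_schroeder_paths n"
      then have p: "UH_free_path_from 0 0 p" "sum_list (map dx p) = 2 * int n"
        by (auto simp: UH_free_schroeder_paths_iff)
      with inv[OF p(1)] dx[OF p(1), of "phi_inv_from 1 [] 0 p"]
      show "length (phi_inv_from 1 [] 0 p) = n \<and> restricted_growth 1 (phi_inv_from 1 [] 0 p) \<and>
          sorted (low_letters 1 (phi_inv_from 1 [] 0 p))"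
        by simp
    qed
  qed
  moreover have "bij_betw (phi_from 1) ?V X \<longleftrightarrow> bij_betw (phi \<circ> (#) 1) ?V X" for X
    by (intro bij_betw_cong) (use phi_Cons_1 in simp)
  ultimately show ?thesis
    using bij_betw_comp_iff[OF cons] by blast
qed

theorem theorem3:
  fixes n :: nat
  shows "bij_betw (\<lambda>P. phi (canonical_word (n + 1) P))
           (avoiding_partitions (n + 1) [1, 2, 3, 2, 1])
           (UH_free_schroeder_paths n)"
proof -
  let ?W = "{w. length w = n + 1 \<and> restricted_growth 0 w \<and> sorted (low_letters 0 w)}"
  have W: "?W = {w \<in> {w. length w = n + 1 \<and> restricted_growth 0 w}. avoids w [1, 2, 3, 2, 1]}"
    using avoids_12321_iff_sorted_low_letters by auto
  \<comment> \<open>Avoidance is a condition on the canonical word, so the bijection with restricted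
    growth words restricts to it.\<close>
  have "bij_betw (canonical_word (n + 1))
      {P \<in> {P. partition_on {1..n + 1} P}. avoids (canonical_word (n + 1) P) [1, 2, 3, 2, 1]} ?W"
    unfolding W by (rule bij_betw_Collect[OF bij_betw_canonical_word]) (rule refl)
  then have "bij_betw (canonical_word (n + 1)) (avoiding_partitions (n + 1) [1, 2, 3, 2, 1]) ?W"
    unfolding avoiding_partitions_def mem_Collect_eq .
  from bij_betw_trans[OF this bij_betw_phi] show ?thesis
    by (simp add: comp_def)
qed

end
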